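(* There is a deterministic protocol for the ad-hoc radio network model (defined in the context) such that, for every acyclic directed graph $G$ with $n$ vertices, labels from $\{0,1,\dots,n-1\}$, and a designated target node $t$ reachable from all other nodes, the protocol completes information gathering on $G$ within $O(n^{1.5}\log^3 n)$ time steps.
   Context: Ad-hoc radio network model: the network is a directed graph $G$ on $n$ nodes, each node having a distinct label from $\{0,1,\dots,n-1\}$; nodes know $n$ and their own label, but the topology of $G$ is unknown to them. Time proceeds in synchronous discrete steps $0,1,2,\dots$, and all nodes start the protocol simultaneously at step $0$. In each step each node is either transmitting (sending one message) or receiving. If node $u$ transmits in a step, the message reaches all out-neighbors of $u$; a receiving node $v$ receives a message in that step if and only if exactly one in-neighbor of $v$ transmits in that step; if two or more in-neighbors transmit, $v$ receives nothing and cannot distinguish this from silence (no collision detection). A transmitting node gets no feedback about whether its transmission was received. Messages have unbounded size (a node may, e.g., include all rumors it knows). A deterministic protocol specifies, for each node, whether and what to transmit at each step as a function of its label, $n$, and the messages it has received so far. Information gathering: each node initially holds a unique piece of information (its rumor); there is a designated target node $t$ reachable by directed paths from all nodes; the task is completed when $t$ holds all $n$ rumors. The running time is the number of steps until completion, in the worst case over all such graphs and labelings. *)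

theory Defs
  imports Complex_Main "HOL-Library.Landau_Symbols"
begin

text \<open>
  Nodes are identified with their labels, so a network on \<open>n\<close> nodes is an edge relation
  on \<open>{..<n}\<close>; the pair \<open>(u, v)\<close> is an edge from \<open>u\<close> to \<open>v\<close>.
  A rumor is an indivisible token, named by the node that initially holds it. A message carries
  a set of rumors together with arbitrary further data, encoded as a list of numbers of
  unbounded size.
\<close>

datatype message = Message (rumors: "nat set") (content: "nat list")

text \<open>
  Entry \<open>i\<close> of a history is what the node got in step \<open>i\<close>. The entry
  \<open>None\<close> covers silence, a collision, and a step in which the node itself was
  transmitting; it carries no information about which of these occurred.
\<close>

type_synonym history = "message option list"

definition held_rumors :: "nat \<Rightarrow> history \<Rightarrow> nat set" where
  "held_rumors v h = insert v (\<Union>m\<in>{m. Some m \<in> set h}. rumors m)"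

text \<open>
  Arguments of a protocol: the number of nodes, the own label, and the history; the length of
  the history is the number of the current step. The result is \<open>Some m\<close> for transmitting
  \<open>m\<close> and \<open>None\<close> for receiving.
\<close>

type_synonym protocol = "nat \<Rightarrow> nat \<Rightarrow> history \<Rightarrow> message option"

text \<open>A node cannot send rumors that it does not hold.\<close>

definition admissible_protocol :: "protocol \<Rightarrow> bool" where
  "admissible_protocol P \<longleftrightarrow>
     (\<forall>n v h m. v < n \<longrightarrow> P n v h = Some m \<longrightarrow> rumors m \<subseteq> held_rumors v h)"

definition reception :: "(nat \<times> nat) set \<Rightarrow> (nat \<Rightarrow> message option) \<Rightarrow> nat \<Rightarrow> message option" where
  "reception E act v =
     (if act v = None \<and> (\<exists>!u. (u, v) \<in> E \<and> act u \<noteq> None)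
      then act (THE u. (u, v) \<in> E \<and> act u \<noteq> None)
      else None)"

text \<open>The history of node \<open>v\<close> after the first \<open>s\<close> steps, that is, steps \<open>0\<close> to \<open>s - 1\<close>:\<close>

primrec run :: "protocol \<Rightarrow> nat \<Rightarrow> (nat \<times> nat) set \<Rightarrow> nat \<Rightarrow> nat \<Rightarrow> history" where
  "run P n E 0 = (\<lambda>v. [])"
| "run P n E (Suc s) =
     (\<lambda>v. run P n E s v @ [reception E (\<lambda>u. P n u (run P n E s u)) v])"

definition gathers_within :: "protocol \<Rightarrow> nat \<Rightarrow> (nat \<times> nat) set \<Rightarrow> nat \<Rightarrow> nat \<Rightarrow> bool" where
  "gathers_within P n E t s \<longleftrightarrow> {..<n} \<subseteq> held_rumors t (run P n E s t)"

end

theory Submission imports Defs "HOL-Library.FuncSet" begin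

text \<open>
  The protocol interleaves round robin with one process for each scale \<open>k = 2\<^sup>j\<close> up to about
  \<open>\<surd>n\<close>. Process \<open>k\<close> repeats a strong selector of length \<open>O(k\<^sup>2 log n)\<close>, which isolates every node
  from any \<open>k\<close> others, and a node takes part in it only as long as its set of rumors has changed
  within the last period of the selector.

  Let \<open>c w\<close> be the time at which \<open>w\<close> knows the rumors of all its ancestors. If the target is not
  complete at time \<open>\<tau>\<close>, take a minimal incomplete node \<open>v\<close> and an in-neighbor \<open>u\<close> that \<open>v\<close> has not heard
  since \<open>c u\<close>. For the largest scale \<open>k\<close> whose period fits between \<open>c u\<close> and \<open>\<tau>\<close>, the selector failed
  to isolate \<open>u\<close> right after \<open>c u\<close>, so at least \<open>k\<close> in-neighbors of \<open>v\<close> were taking part. These are complete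
  by time \<open>\<tau>\<close> and were not complete long before \<open>c u\<close>, so at least \<open>k\<close> nodes complete within
  \<open>O(k\<^sup>2 log\<^sup>2 n)\<close> steps before \<open>\<tau>\<close>. Since each node completes only once, double counting bounds the
  number of such \<open>\<tau>\<close> by the sum of \<open>n / k \<sqdot> O(k\<^sup>2 log\<^sup>2 n)\<close> over all scales, which is
  \<open>O(n\<^sup>1\<^sup>.\<^sup>5 log\<^sup>2 n)\<close>.
\<close>

section \<open>Separating families of functions\<close>

text \<open>The competitors are a list, not a set, so that pairs with lists of length
  \<open>k\<close> are counted by a power of \<open>n\<close>.\<close>

definition collides :: "(nat \<Rightarrow> nat) \<Rightarrow> nat \<times> nat list \<Rightarrow> bool" where
  "collides f d \<longleftrightarrow> f (fst d) \<in> f ` set (snd d)"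

text \<open>Overwriting the value at \<open>u\<close> by any of the \<open>q\<close> values is
  injective on the functions with \<open>f u = f w\<close>: the lost value is still readable at
  \<open>w\<close>.\<close>

lemma card_PiE_agree:
  fixes n q u w :: nat
  assumes "u < n" "w < n" "u \<noteq> w"
  shows "card {f \<in> {..<n} \<rightarrow>\<^sub>E {..<q}. f u = f w} * q \<le> card ({..<n} \<rightarrow>\<^sub>E {..<q})"
proof -
  let ?F = "{..<n} \<rightarrow>\<^sub>E {..<q}"
  let ?A = "{f \<in> ?F. f u = f w}"
  let ?g = "\<lambda>(f, c). f(u := c)"
  have fin: "finite ?F" by (intro finite_PiE) auto
  have "inj_on ?g (?A \<times> {..<q})"
  proof (rule inj_onI, clarify)
    fix f c f' c'
    assume "f u = f w" "f' u = f' w" and eq: "f(u := c) = f'(u := c')"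
    have "f x = f' x" for x
      using fun_cong[OF eq, of x] fun_cong[OF eq, of w] assms \<open>f u = f w\<close> \<open>f' u = f' w\<close>
      by (cases "x = u") auto
    moreover have "c = c'" using fun_cong[OF eq, of u] by simp
    ultimately show "f = f' \<and> c = c'" by auto
  qed
  moreover have "?g ` (?A \<times> {..<q}) \<subseteq> ?F"
    using assms by (auto simp: PiE_iff extensional_def split: if_splits)
  ultimately have "card (?A \<times> {..<q}) \<le> card ?F"
    using card_inj_on_le fin by blast
  then show ?thesis by (simp add: card_cartesian_product)
qed

text \<open>Union bound: each of at most \<open>k\<close> competitors agrees with \<open>u\<close>
  for at most a fraction \<open>1 / (2 * k)\<close> of the functions.\<close>

lemma card_PiE_collides:
  assumes "u < n" "set xs \<subseteq> {..<n}" "u \<notin> set xs" "length xs \<le> k"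
  shows "2 * card {f \<in> {..<n} \<rightarrow>\<^sub>E {..<2 * k}. collides f (u, xs)} \<le> card ({..<n} \<rightarrow>\<^sub>E {..<2 * k})"
proof (cases "k = 0")
  case True
  then show ?thesis using assms by (simp add: collides_def)
next
  case False
  let ?F = "{..<n} \<rightarrow>\<^sub>E {..<2 * k}"
  let ?A = "\<lambda>w. {f \<in> ?F. f u = f w}"
  have fin: "finite ?F" by (intro finite_PiE) auto
  have "{f \<in> ?F. collides f (u, xs)} = (\<Union>w\<in>set xs. ?A w)"
    by (auto simp: collides_def)
  then have "card {f \<in> ?F. collides f (u, xs)} \<le> (\<Sum>w\<in>set xs. card (?A w))"
    using card_UN_le[of "set xs" ?A] by simp
  then have "card {f \<in> ?F. collides f (u, xs)} * (2 * k) \<le> (\<Sum>w\<in>set xs. card (?A w)) * (2 * k)"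
    by (rule mult_le_mono1)
  also have "\<dots> = (\<Sum>w\<in>set xs. card (?A w) * (2 * k))" by (rule sum_distrib_right)
  also have "\<dots> \<le> (\<Sum>w\<in>set xs. card ?F)"
    by (intro sum_mono card_PiE_agree) (use assms in auto)
  also have "\<dots> \<le> k * card ?F"
    using card_length[of xs] assms(4) by simp
  finally show ?thesis using False by simp
qed

text \<open>Averaging: after exchanging the sums, a random function collides on at most half of
  \<open>D\<close> in expectation.\<close>

lemma ex_function_few_collisions:
  assumes "finite D" "k > 0"
    and D: "\<And>u xs. (u, xs) \<in> D \<Longrightarrow> u < n \<and> set xs \<subseteq> {..<n} \<and> u \<notin> set xs \<and> length xs \<le> k"
  shows "\<exists>f. (\<forall>x<n. f x < 2 * k) \<and> 2 * card {d \<in> D. collides f d} \<le> card D"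
proof (rule ccontr)
  let ?F = "{..<n} \<rightarrow>\<^sub>E {..<2 * k}"
  assume contra: "\<not> ?thesis"
  have fin: "finite ?F" by (intro finite_PiE) auto
  have ne: "?F \<noteq> {}" using \<open>k > 0\<close> by (auto simp: PiE_eq_empty_iff lessThan_empty_iff)
  have "(\<Sum>f\<in>?F. card D) < (\<Sum>f\<in>?F. 2 * card {d \<in> D. collides f d})"
  proof (rule sum_strict_mono[OF fin ne])
    fix f assume "f \<in> ?F"
    then have "\<forall>x<n. f x < 2 * k" by (auto simp: PiE_iff)
    with contra show "card D < 2 * card {d \<in> D. collides f d}" by (meson not_le)
  qed
  also have "\<dots> = 2 * (\<Sum>f\<in>?F. \<Sum>d\<in>D. of_bool (collides f d))"
    using \<open>finite D\<close> by (simp add: sum_distrib_left Int_def)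
  also have "\<dots> = 2 * (\<Sum>d\<in>D. \<Sum>f\<in>?F. of_bool (collides f d))"
    by (subst sum.swap) simp
  also have "\<dots> = (\<Sum>d\<in>D. 2 * card {f \<in> ?F. collides f d})"
    using fin by (simp add: sum_distrib_left Int_def)
  also have "\<dots> \<le> (\<Sum>d\<in>D. card ?F)"
  proof (rule sum_mono)
    fix d assume "d \<in> D"
    then show "2 * card {f \<in> ?F. collides f d} \<le> card ?F"
      using D[of "fst d" "snd d"] card_PiE_collides[of "fst d" n "snd d" k] by simp
  qed
  finally show False by (simp add: mult.commute)
qed

text \<open>Each further function, chosen by averaging, halves the number of remaining collisions.\<close>

lemma ex_functions_few_collisions:
  assumes "finite D" "k > 0"
    and D: "\<And>u xs. (u, xs) \<in> D \<Longrightarrow> u < n \<and> set xs \<subseteq> {..<n} \<and> u \<notin> set xs \<and> length xs \<le> k"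
  shows "\<exists>f. (\<forall>i. \<forall>x<n. f i x < 2 * k) \<and> 2 ^ l * card {d \<in> D. \<forall>i<l. collides (f i) d} \<le> card D"
proof (induction l)
  case 0
  show ?case using \<open>k > 0\<close> by (intro exI[of _ "\<lambda>_ _. 0"]) simp
next
  case (Suc l)
  then obtain f where f: "\<forall>i. \<forall>x<n. f i x < 2 * k"
    and card_f: "2 ^ l * card {d \<in> D. \<forall>i<l. collides (f i) d} \<le> card D" by blast
  let ?D = "{d \<in> D. \<forall>i<l. collides (f i) d}"
  have "\<exists>g. (\<forall>x<n. g x < 2 * k) \<and> 2 * card {d \<in> ?D. collides g d} \<le> card ?D"
    by (rule ex_function_few_collisions) (use assms in auto)
  then obtain g where g: "\<forall>x<n. g x < 2 * k" "2 * card {d \<in> ?D. collides g d} \<le> card ?D"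
    by blast
  have "{d \<in> D. \<forall>i<Suc l. collides ((f(l := g)) i) d} = {d \<in> ?D. collides g d}"
    by (auto simp: less_Suc_eq)
  then have "2 ^ Suc l * card {d \<in> D. \<forall>i<Suc l. collides ((f(l := g)) i) d}
      = 2 ^ l * (2 * card {d \<in> ?D. collides g d})" by simp
  also have "\<dots> \<le> card D" using card_f g(2) by (meson le_trans mult_le_mono2)
  finally show ?case using f g(1) by (intro exI[of _ "f(l := g)"]) auto
qed

definition separating :: "nat \<Rightarrow> nat \<Rightarrow> nat \<Rightarrow> (nat \<Rightarrow> nat \<Rightarrow> nat) \<Rightarrow> bool" where
  "separating n k l f \<longleftrightarrow> (\<forall>i. \<forall>x<n. f i x < 2 * k) \<and>
     (\<forall>u<n. \<forall>X\<subseteq>{..<n}. X \<noteq> {} \<longrightarrow> card X \<le> k \<longrightarrow> u \<notin> X \<longrightarrow> (\<exists>i<l. f i u \<notin> f i ` X))"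

text \<open>There are fewer than \<open>2 ^ (B * (k + 1))\<close> pairs, so after that many halvings
  no collision is left.\<close>

lemma ex_separating:
  assumes "n < 2 ^ B" "k > 0"
  shows "\<exists>f. separating n k (B * (k + 1)) f"
proof -
  let ?L = "{xs. set xs \<subseteq> {..<n} \<and> length xs = k}"
  let ?D = "{d \<in> {..<n} \<times> ?L. fst d \<notin> set (snd d)}"
  let ?l = "B * (k + 1)"
  have finL: "finite ?L" by (rule finite_lists_length_eq) simp
  have finD: "finite ?D" using finL by simp
  have "card ?D \<le> card ({..<n} \<times> ?L)" by (rule card_mono) (use finL in auto)
  also have "\<dots> = n ^ (k + 1)" by (simp add: card_cartesian_product card_lists_length_eq)
  also have "\<dots> < (2 ^ B) ^ (k + 1)" using assms by (intro power_strict_mono) auto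
  finally have cardD: "card ?D < 2 ^ ?l" by (simp only: power_mult)
  have "\<exists>f. (\<forall>i. \<forall>x<n. f i x < 2 * k) \<and> 2 ^ ?l * card {d \<in> ?D. \<forall>i<?l. collides (f i) d} \<le> card ?D"
    by (rule ex_functions_few_collisions) (use finD assms in auto)
  then obtain f where f: "\<forall>i. \<forall>x<n. f i x < 2 * k"
    and few: "2 ^ ?l * card {d \<in> ?D. \<forall>i<?l. collides (f i) d} \<le> card ?D" by blast
  have "card {d \<in> ?D. \<forall>i<?l. collides (f i) d} = 0"
  proof (rule ccontr)
    assume "card {d \<in> ?D. \<forall>i<?l. collides (f i) d} \<noteq> 0"
    then have "2 ^ ?l * 1 \<le> 2 ^ ?l * card {d \<in> ?D. \<forall>i<?l. collides (f i) d}"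
      by (intro mult_le_mono2) linarith
    with few cardD show False by linarith
  qed
  moreover have "finite {d \<in> ?D. \<forall>i<?l. collides (f i) d}"
    by (rule finite_subset[OF _ finD]) blast
  ultimately have none: "{d \<in> ?D. \<forall>i<?l. collides (f i) d} = {}" by (simp only: card_0_eq)
  have "\<exists>i<?l. f i u \<notin> f i ` X" if "u < n" "X \<subseteq> {..<n}" "X \<noteq> {}" "card X \<le> k" "u \<notin> X" for u X
  proof -
    have "finite X" using that(2) finite_subset by blast
    then obtain ys where ys: "set ys = X" "length ys = card X"
      by (metis distinct_card finite_distinct_list)
    obtain x where "x \<in> X" using \<open>X \<noteq> {}\<close> by blast
    \<comment> \<open>Repeating an element pads the list to length exactly \<open>k\<close> without
      changing its set.\<close>
    define xs where "xs = ys @ replicate (k - card X) x"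
    have xs: "set xs = X" "length xs = k" using ys \<open>x \<in> X\<close> that(4) by (auto simp: xs_def)
    then have "(u, xs) \<in> ?D" using that by simp
    then have "\<not> (\<forall>i<?l. collides (f i) (u, xs))" using none by blast
    then show ?thesis using xs by (auto simp: collides_def)
  qed
  then show ?thesis using f unfolding separating_def by blast
qed

section \<open>Time slots and double counting\<close>

lemma ex_mod_eq_in_window:
  fixes a d x :: nat
  assumes "x < d"
  shows "\<exists>s\<ge>a. s < a + d \<and> s mod d = x"
proof (cases "a mod d \<le> x")
  case True
  have "(a - a mod d + x) mod d = x" using assms
    by (metis minus_mod_eq_mult_div mod_less mod_mult_self4)
  moreover have "a \<le> a - a mod d + x" "a - a mod d + x < a + d"
    using True assms mod_less_eq_dividend[of a d] by linarith+
  ultimately show ?thesis by blast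
next
  case False
  have "(a - a mod d + (x + d)) mod d = x" using assms
    by (metis minus_mod_eq_mult_div mod_less mod_mult_self4 mod_add_self2)
  moreover have "a mod d < d" using assms by simp
  then have "a \<le> a - a mod d + (x + d)" "a - a mod d + (x + d) < a + d"
    using False assms mod_less_eq_dividend[of a d] by linarith+
  ultimately show ?thesis by blast
qed

text \<open>Both conditions together fix one residue modulo \<open>M * L\<close>, with
  \<open>j\<close> and \<open>i\<close> as its mixed-radix digits.\<close>

lemma ex_interleaved_slot:
  fixes a M L i j :: nat
  assumes "j < M" "i < L"
  shows "\<exists>s\<ge>a. s < a + M * L \<and> s mod M = j \<and> (s div M) mod L = i"
proof -
  have "M * i + j < M * i + M" using assms by simp
  also have "\<dots> \<le> M * L" using assms(2) by (metis Suc_leI mult_Suc_right add.commute mult_le_mono2)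
  finally obtain s where s: "s \<ge> a" "s < a + M * L" "s mod (M * L) = M * i + j"
    using ex_mod_eq_in_window by blast
  have "s mod (M * L) = M * (s div M mod L) + s mod M" by (rule mod_mult2_eq)
  with s(3) have eq: "M * (s div M mod L) + s mod M = M * i + j" by simp
  have "s mod M = (M * (s div M mod L) + s mod M) mod M" by simp
  also have "\<dots> = j" unfolding eq using assms by simp
  finally have "s mod M = j" .
  with eq assms have "s div M mod L = i" by simp
  with s \<open>s mod M = j\<close> show ?thesis by blast
qed

text \<open>For fixed \<open>j\<close>, each \<open>w\<close> is counted at no more than
  \<open>V j\<close> times \<tau>, while every \<tau> receives total weight at least 1 when scale
  \<open>j\<close> is weighted by \<open>1 / k j\<close>.\<close>

lemma crowded_times_double_counting:
  fixes c :: "nat \<Rightarrow> nat" and k V :: "nat \<Rightarrow> nat"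
  assumes "\<And>j. k j > 0"
    and dense: "\<And>\<tau>. \<tau> < T \<Longrightarrow> \<exists>j<J. k j \<le> card {w. w < n \<and> c w \<le> \<tau> \<and> \<tau> < c w + V j}"
  shows "real T \<le> (\<Sum>j<J. real n * real (V j) / real (k j))"
proof -
  let ?N = "\<lambda>j \<tau>. {w. w < n \<and> c w \<le> \<tau> \<and> \<tau> < c w + V j}"
  have N: "(\<Sum>\<tau><T. card (?N j \<tau>)) \<le> n * V j" for j
  proof -
    have "(\<Sum>\<tau><T. card (?N j \<tau>)) = (\<Sum>\<tau><T. \<Sum>w<n. of_bool (c w \<le> \<tau> \<and> \<tau> < c w + V j))"
      by (intro sum.cong refl) (simp add: Int_def)
    also have "\<dots> = (\<Sum>w<n. \<Sum>\<tau><T. of_bool (c w \<le> \<tau> \<and> \<tau> < c w + V j))"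
      by (rule sum.swap)
    also have "\<dots> \<le> (\<Sum>w<n. V j)"
    proof (rule sum_mono)
      fix w
      have "(\<Sum>\<tau><T. of_bool (c w \<le> \<tau> \<and> \<tau> < c w + V j)) = card ({..<T} \<inter> {\<tau>. c w \<le> \<tau> \<and> \<tau> < c w + V j})"
        by simp
      also have "\<dots> \<le> card {c w..<c w + V j}" by (rule card_mono) auto
      finally show "(\<Sum>\<tau><T. of_bool (c w \<le> \<tau> \<and> \<tau> < c w + V j)) \<le> V j" by simp
    qed
    finally show ?thesis by simp
  qed
  have "real T = (\<Sum>\<tau><T. 1)" by simp
  also have "\<dots> \<le> (\<Sum>\<tau><T. \<Sum>j<J. real (card (?N j \<tau>)) / real (k j))"
  proof (rule sum_mono)
    fix \<tau> assume "\<tau> \<in> {..<T}"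
    then obtain j where j: "j < J" "k j \<le> card (?N j \<tau>)" using dense by blast
    then have "1 \<le> real (card (?N j \<tau>)) / real (k j)" using assms(1)[of j] by simp
    also have "\<dots> \<le> (\<Sum>j<J. real (card (?N j \<tau>)) / real (k j))"
      by (rule member_le_sum) (use j in auto)
    finally show "1 \<le> (\<Sum>j<J. real (card (?N j \<tau>)) / real (k j))" .
  qed
  also have "\<dots> = (\<Sum>j<J. real (\<Sum>\<tau><T. card (?N j \<tau>)) / real (k j))"
    by (subst sum.swap) (simp add: sum_divide_distrib)
  also have "\<dots> \<le> (\<Sum>j<J. real n * real (V j) / real (k j))"
    by (intro sum_mono divide_right_mono)
       (use N in \<open>simp_all only: of_nat_mult[symmetric] of_nat_le_iff of_nat_0_le_iff\<close>)
  finally show ?thesis .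
qed

section \<open>Histories\<close>

lemma length_run [simp]: "length (run P n E s v) = s"
  by (induction s) simp_all

lemma take_run: "a \<le> s \<Longrightarrow> take a (run P n E s v) = run P n E a v"
proof (induction s)
  case (Suc s)
  then show ?case by (cases "a = Suc s") auto
qed simp

lemma held_rumors_snoc:
  "held_rumors v (h @ [r]) = held_rumors v h \<union> (case r of None \<Rightarrow> {} | Some m \<Rightarrow> rumors m)"
  by (auto simp: held_rumors_def split: option.splits)

section \<open>The protocol\<close>

definition bits :: "nat \<Rightarrow> nat" where
  "bits n = (LEAST B. n < 2 ^ B)"

text \<open>For positive \<open>n\<close>, the base-4 logarithm rounded up, so that
  \<open>2 ^ num_scales n\<close> is about the square root of \<open>n\<close>.\<close>

definition num_scales :: "nat \<Rightarrow> nat" where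
  "num_scales n = (LEAST J. n \<le> 4 ^ J)"

definition num_processes :: "nat \<Rightarrow> nat" where
  "num_processes n = num_scales n + 1"

text \<open>The choice depends on \<open>n\<close> and \<open>j\<close> alone, so all nodes use the
  same family.\<close>

definition hash :: "nat \<Rightarrow> nat \<Rightarrow> nat \<Rightarrow> nat \<Rightarrow> nat" where
  "hash n j = (SOME f. separating n (2 ^ j) (bits n * (2 ^ j + 1)) f)"

definition selector_length :: "nat \<Rightarrow> nat \<Rightarrow> nat" where
  "selector_length n j = bits n * (2 ^ j + 1) * (2 * 2 ^ j)"

text \<open>Process \<open>j\<close> owns one step in \<open>num_processes n\<close>, so a full
  selector period stretches to this many steps.\<close>

definition window :: "nat \<Rightarrow> nat \<Rightarrow> nat" where
  "window n j = num_processes n * selector_length n j"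

text \<open>Time \<open>0\<close> counts as a change of the rumor set, hence the first disjunct.\<close>

definition fresh :: "nat \<Rightarrow> nat \<Rightarrow> history \<Rightarrow> bool" where
  "fresh W v h \<longleftrightarrow> length h < W \<or> held_rumors v (take (length h - W) h) \<noteq> held_rumors v h"

text \<open>
  Process \<open>num_scales n\<close> is round robin. In process \<open>j\<close>, slot \<open>p\<close> of the selector belongs to the nodes
  that function number \<open>p div (2 * 2 ^ j)\<close> of the separating family maps to \<open>p mod (2 * 2 ^ j)\<close>.
\<close>

definition transmits :: "nat \<Rightarrow> nat \<Rightarrow> history \<Rightarrow> bool" where
  "transmits n v h \<longleftrightarrow>
     (let j = length h mod num_processes n; r = length h div num_processes n;
          p = r mod selector_length n j
      in if j = num_scales n then r mod n = v
         else fresh (window n j) v h \<and> hash n j (p div (2 * 2 ^ j)) v = p mod (2 * 2 ^ j))"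

definition gather :: protocol where
  "gather n v h = (if transmits n v h then Some (Message (held_rumors v h) []) else None)"

lemma admissible_gather: "admissible_protocol gather"
  by (auto simp: admissible_protocol_def gather_def split: if_splits)

section \<open>Bounds on the protocol parameters\<close>

lemma less_power_bits: "n < 2 ^ bits n"
  unfolding bits_def by (rule LeastI[of _ n]) (rule less_exp)

lemma le_power_num_scales: "n \<le> 4 ^ num_scales n"
proof -
  have "n < 2 ^ n" by (rule less_exp)
  also have "(2::nat) ^ n \<le> 4 ^ n" by (rule power_mono) auto
  finally show ?thesis unfolding num_scales_def by (intro LeastI[of "\<lambda>J. n \<le> 4 ^ J" n]) simp
qed

lemma separating_hash: "separating n (2 ^ j) (bits n * (2 ^ j + 1)) (hash n j)"
  unfolding hash_def by (rule someI_ex[OF ex_separating]) (simp_all add: less_power_bits)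

lemma bits_pos: "n > 0 \<Longrightarrow> bits n > 0"
  using less_power_bits[of n] by (cases "bits n") auto

text \<open>One round-robin pass fits into the formal window at index \<open>num_scales n\<close>;
  this guarantees a least scale whose window has not yet elapsed.\<close>

lemma le_window_num_scales: "num_processes n * n \<le> window n (num_scales n)"
proof (cases "n = 0")
  case False
  have "n \<le> 4 ^ num_scales n" by (rule le_power_num_scales)
  also have "\<dots> = 1 * 2 ^ num_scales n * 2 ^ num_scales n"
    by (simp flip: power_mult_distrib)
  also have "\<dots> \<le> bits n * (2 ^ num_scales n + 1) * (2 * 2 ^ num_scales n)"
    using bits_pos[of n] False by (intro mult_le_mono) auto
  finally show ?thesis unfolding window_def selector_length_def by (rule mult_le_mono2)
qed simp

section \<open>Knowledge, completion times and freshness\<close>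

locale acyclic_network =
  fixes n :: nat and E :: "(nat \<times> nat) set"
  assumes edges: "E \<subseteq> {..<n} \<times> {..<n}" and acyclic: "acyclic E"
begin

abbreviation knows :: "nat \<Rightarrow> nat \<Rightarrow> nat set" where
  "knows s v \<equiv> held_rumors v (run gather n E s v)"

abbreviation sends :: "nat \<Rightarrow> nat \<Rightarrow> bool" where
  "sends s v \<equiv> transmits n v (run gather n E s v)"

definition ancestors :: "nat \<Rightarrow> nat set" where
  "ancestors v = {u. (u, v) \<in> E\<^sup>*}"

definition complete :: "nat \<Rightarrow> nat \<Rightarrow> bool" where
  "complete s v \<longleftrightarrow> knows s v = ancestors v"

text \<open>Unspecified for a node that never completes; the counting only needs one fixed value per
  node.\<close>

definition completion :: "nat \<Rightarrow> nat" where
  "completion v = (LEAST s. complete s v)"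

lemma knows_mono: "s \<le> s' \<Longrightarrow> knows s v \<subseteq> knows s' v"
  by (rule lift_Suc_mono_le[of "\<lambda>s. knows s v"]) (auto simp: held_rumors_snoc)

lemma knows_subset_ancestors: "knows s v \<subseteq> ancestors v"
proof (induction s arbitrary: v)
  case 0
  show ?case by (simp add: held_rumors_def ancestors_def)
next
  case (Suc s)
  define act where "act = (\<lambda>u. gather n u (run gather n E s u))"
  have "rumors m \<subseteq> ancestors v" if m: "reception E act v = Some m" for m
  proof -
    have ex1: "\<exists>!u. (u, v) \<in> E \<and> act u \<noteq> None"
      and val: "act (THE u. (u, v) \<in> E \<and> act u \<noteq> None) = Some m"
      using m by (auto simp: reception_def split: if_splits)
    define u where "u = (THE u. (u, v) \<in> E \<and> act u \<noteq> None)"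
    have "(u, v) \<in> E" using theI'[OF ex1] by (simp add: u_def)
    moreover have "act u = Some m" using val by (simp only: u_def)
    then have "rumors m = knows s u" by (auto simp: act_def gather_def split: if_splits)
    ultimately show ?thesis
      using Suc.IH[of u] by (auto simp: ancestors_def)
  qed
  then show ?case
    using Suc.IH[of v] by (auto simp: held_rumors_snoc act_def[symmetric] split: option.splits)
qed

lemma complete_mono: "complete s v \<Longrightarrow> s \<le> s' \<Longrightarrow> complete s' v"
  using knows_mono[of s s' v] knows_subset_ancestors[of v s'] by (auto simp: complete_def)

lemma complete_completion: "complete s v \<Longrightarrow> complete (completion v) v"
  unfolding completion_def by (rule LeastI)

lemma completion_le: "complete s v \<Longrightarrow> completion v \<le> s"
  unfolding completion_def by (rule Least_le)

text \<open>A look back by \<open>W\<close> steps reaches a time before completion, or before the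
  start, so the node still takes part.\<close>

lemma fresh_after_completion:
  assumes "complete \<tau> v" "completion v \<le> s" "s < completion v + W"
  shows "fresh W v (run gather n E s v)"
proof (cases "s < W")
  case False
  then have "s - W < completion v" using assms by linarith
  then have "\<not> complete (s - W) v" unfolding completion_def by (rule not_less_Least)
  moreover have "complete s v" using complete_mono complete_completion assms by blast
  ultimately show ?thesis by (auto simp: fresh_def complete_def take_run)
qed (simp add: fresh_def)

lemma fresh_imp_recent:
  assumes "complete \<tau> v" "fresh W v (run gather n E s v)"
  shows "s < completion v + W"
proof (rule ccontr)
  assume "\<not> ?thesis"
  then have "complete (s - W) v" "complete s v" "W \<le> s"
    using complete_mono complete_completion assms(1) by fastforce+
  with assms(2) show False by (auto simp: fresh_def complete_def take_run)
qed

lemma knows_after_reception: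
  assumes "(u, v) \<in> E" "sends s u" "\<not> sends s v" "\<And>w. (w, v) \<in> E \<Longrightarrow> sends s w \<Longrightarrow> w = u"
  shows "knows s u \<subseteq> knows (Suc s) v"
proof -
  define act where "act = (\<lambda>u. gather n u (run gather n E s u))"
  have act: "act w \<noteq> None \<longleftrightarrow> sends s w" for w by (simp add: act_def gather_def)
  have ex1: "\<exists>!w. (w, v) \<in> E \<and> act w \<noteq> None" unfolding act using assms by blast
  moreover have "(THE w. (w, v) \<in> E \<and> act w \<noteq> None) = u"
    by (rule the1_equality[OF ex1]) (use assms(1,2) act in blast)
  moreover have "act v = None" using act assms(3) by blast
  ultimately have "reception E act v = act u" by (simp add: reception_def)
  also have "act u = Some (Message (knows s u) [])" using assms(2) by (simp add: act_def gather_def)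
  finally show ?thesis by (simp add: held_rumors_snoc act_def[symmetric])
qed

text \<open>Otherwise \<open>v\<close> has received the full ancestor set of every in-neighbor, and
  these sets together with \<open>v\<close> make up all its ancestors.\<close>

lemma ex_unheard_in_neighbor:
  assumes "\<not> complete \<tau> v" "\<And>u. (u, v) \<in> E \<Longrightarrow> complete \<tau> u"
  shows "\<exists>u. (u, v) \<in> E \<and> (\<forall>s. completion u \<le> s \<longrightarrow> s < \<tau> \<longrightarrow> sends s u \<longrightarrow>
           sends s v \<or> (\<exists>w. w \<noteq> u \<and> (w, v) \<in> E \<and> sends s w))"
proof (rule ccontr)
  assume contra: "\<not> ?thesis"
  have "ancestors u \<subseteq> knows \<tau> v" if uv: "(u, v) \<in> E" for u
  proof -
    obtain s where s: "completion u \<le> s" "s < \<tau>" "sends s u" "\<not> sends s v"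
      "\<And>w. (w, v) \<in> E \<Longrightarrow> sends s w \<Longrightarrow> w = u" using contra uv by blast
    have "complete s u" using complete_mono complete_completion assms(2)[OF uv] s(1) by blast
    then have "ancestors u = knows s u" by (simp add: complete_def)
    also have "\<dots> \<subseteq> knows (Suc s) v" using uv s(3-5) by (rule knows_after_reception)
    also have "\<dots> \<subseteq> knows \<tau> v" by (rule knows_mono) (use s in simp)
    finally show ?thesis .
  qed
  moreover have "v \<in> knows \<tau> v" by (simp add: held_rumors_def)
  ultimately have "ancestors v \<subseteq> knows \<tau> v"
    by (auto simp: ancestors_def elim: rtranclE)
  with knows_subset_ancestors[of v \<tau>] assms(1) show False by (auto simp: complete_def)
qed

section \<open>Crowding caused by an unheard in-neighbor\<close>

context
  fixes \<tau> u v :: nat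
  assumes in_neighbors: "\<And>w. (w, v) \<in> E \<Longrightarrow> complete \<tau> w"
    and uv: "(u, v) \<in> E"
    and unheard: "\<And>s. completion u \<le> s \<Longrightarrow> s < \<tau> \<Longrightarrow> sends s u \<Longrightarrow>
           sends s v \<or> (\<exists>w. w \<noteq> u \<and> (w, v) \<in> E \<and> sends s w)"
begin

lemma endpoints: "u < n" "v < n" "u \<noteq> v"
  using uv edges acyclic by (auto simp: acyclic_def)

lemma unheard_less_round_robin: "\<tau> < completion u + num_processes n * n"
proof (rule ccontr)
  assume long: "\<not> ?thesis"
  obtain s where s: "s \<ge> completion u" "s < completion u + num_processes n * n"
    "s mod num_processes n = num_scales n" "s div num_processes n mod n = u"
    using ex_interleaved_slot[of "num_scales n" "num_processes n" u n "completion u"] endpoints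
    by (auto simp: num_processes_def)
  have "sends s w \<longleftrightarrow> w = u" for w
    using s(3,4) by (auto simp: transmits_def Let_def)
  then show False using unheard[of s] s long endpoints by auto
qed

text \<open>Only nodes of this set can compete with \<open>u\<close> during the window. If they were
  at most \<open>2 ^ j\<close>, the selector would isolate \<open>u\<close> and \<open>v\<close>
  would hear it.\<close>

lemma unheard_imp_crowded:
  assumes "j < num_scales n" "completion u + window n j \<le> \<tau>"
  shows "2 ^ j < card {w. w < n \<and> completion w \<le> \<tau> \<and> completion u < completion w + window n j}"
proof (rule ccontr)
  define S where "S = {w. w < n \<and> completion w \<le> \<tau> \<and> completion u < completion w + window n j}"
  assume "\<not> ?thesis"
  then have cardS: "card S \<le> 2 ^ j" by (simp add: S_def)
  have finS: "finite S" by (simp add: S_def)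
  have "window n j > 0"
    using bits_pos[of n] endpoints by (simp add: window_def selector_length_def num_processes_def)
  then have uS: "u \<in> S" using endpoints assms(2) by (simp add: S_def)
  \<comment> \<open>The receiver itself must stay silent, so it counts as a competitor of \<open>u\<close>.\<close>
  define X where "X = insert v (S - {u})"
  define k where "k = (2::nat) ^ j"
  define f where "f = hash n j"
  \<comment> \<open>\<open>u\<close> lies in \<open>S\<close>, so exchanging it for \<open>v\<close>
    does not increase the cardinality.\<close>
  have "card X \<le> Suc (card (S - {u}))" unfolding X_def by (rule card_insert_le_m1) (use finS in auto)
  also have "\<dots> = card S" using finS uS by (rule card_Suc_Diff1)
  finally have "card X \<le> k" using cardS by (simp add: k_def)
  moreover have "X \<subseteq> {..<n}" "X \<noteq> {}" "u \<notin> X" using endpoints by (auto simp: X_def S_def)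
  ultimately obtain i where i: "i < bits n * (k + 1)" "f i u \<notin> f i ` X"
    using separating_hash[of n j] endpoints unfolding separating_def k_def f_def by blast
  have fu: "f i u < 2 * k"
    using separating_hash[of n j] endpoints unfolding separating_def k_def f_def by blast
  \<comment> \<open>The slot that function \<open>i\<close> assigns to \<open>u\<close>.\<close>
  define p where "p = i * (2 * k) + f i u"
  have "p < Suc i * (2 * k)" using fu by (simp add: p_def)
  also have "\<dots> \<le> selector_length n j"
    unfolding selector_length_def k_def[symmetric] using i(1) by (intro mult_le_mono1) simp
  finally have p: "p < selector_length n j" .
  have pdiv: "p div (2 * k) = i" "p mod (2 * k) = f i u" using fu by (simp_all add: p_def)
  obtain s where s: "s \<ge> completion u" "s < completion u + window n j"
    "s mod num_processes n = j" "s div num_processes n mod selector_length n j = p"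
    using ex_interleaved_slot[of j "num_processes n" p "selector_length n j" "completion u"] p assms(1)
    by (auto simp: num_processes_def window_def)
  have sends: "sends s w \<longleftrightarrow> fresh (window n j) w (run gather n E s w) \<and> f i w = f i u" for w
    using s(3,4) assms(1) pdiv by (simp add: transmits_def Let_def k_def f_def)
  have "sends s u"
    using sends fresh_after_completion[OF in_neighbors[OF uv]] s by blast
  moreover have "\<not> sends s v" using sends i(2) by (metis X_def image_eqI insertI1)
  ultimately obtain w where w: "w \<noteq> u" "(w, v) \<in> E" "sends s w"
    using unheard[of s] s assms(2) by auto
  have "s < completion w + window n j"
    using fresh_imp_recent in_neighbors w sends by blast
  then have "w \<in> X"
    using s w completion_le[OF in_neighbors[OF w(2)]] edges by (auto simp: X_def S_def)
  then show False using i(2) w(3) sends by (metis image_eqI)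
qed

text \<open>For the least \<open>j\<close> whose window has not elapsed at \<tau>, scale
  \<open>j - 1\<close> is crowded around \<open>completion u\<close>. Moving the reference time from
  there to \<tau> costs another \<open>window n j\<close>.\<close>

lemma unheard_imp_crowded_now:
  "\<exists>j<num_scales n. 2 ^ j \<le> card {w. w < n \<and> completion w \<le> \<tau> \<and>
     \<tau> < completion w + (window n j + window n (j + 1))}" (is "\<exists>j<_. _ \<le> card (?S j)")
proof -
  have cu: "completion u \<le> \<tau>" using completion_le in_neighbors uv by blast
  define j where "j = (LEAST j. \<tau> < completion u + window n j)"
  have ex: "\<tau> < completion u + window n (num_scales n)"
    using unheard_less_round_robin le_window_num_scales[of n] by linarith
  have j: "\<tau> < completion u + window n j" unfolding j_def by (rule LeastI[of "\<lambda>j. \<tau> < completion u + window n j", OF ex])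
  have jle: "j \<le> num_scales n" unfolding j_def by (rule Least_le[of "\<lambda>j. \<tau> < completion u + window n j", OF ex])
  have finS: "finite (?S i)" for i by simp
  show ?thesis
  proof (cases j)
    case 0
    \<comment> \<open>\<open>u\<close> and \<open>v\<close> differ, so \<open>n\<close> is at least
      2 and scale 0 exists; \<open>u\<close> alone provides the one node it requires.\<close>
    have "num_scales n \<noteq> 0" using le_power_num_scales[of n] endpoints by (auto intro: ccontr)
    moreover have "u \<in> ?S 0" using j 0 cu endpoints by simp
    then have "card {u} \<le> card (?S 0)" by (intro card_mono finS) auto
    ultimately show ?thesis by (intro exI[of _ 0]) simp
  next
    case (Suc i)
    then have "\<not> \<tau> < completion u + window n i" unfolding j_def by (intro not_less_Least) simp
    then have "2 ^ i < card {w. w < n \<and> completion w \<le> \<tau> \<and> completion u < completion w + window n i}"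
      by (intro unheard_imp_crowded) (use Suc jle in auto)
    also have "\<dots> \<le> card (?S i)" by (rule card_mono[OF finS]) (use j Suc in auto)
    finally show ?thesis using Suc jle by (intro exI[of _ i]) simp
  qed
qed

end

lemma incomplete_imp_crowded:
  assumes "\<not> complete \<tau> t"
  shows "\<exists>j<num_scales n. 2 ^ j \<le> card {w. w < n \<and> completion w \<le> \<tau> \<and>
     \<tau> < completion w + (window n j + window n (j + 1))}"
proof -
  have "finite E" using edges finite_subset by blast
  then have "wf E" using acyclic by (rule finite_acyclic_wf)
  then obtain v where v: "\<not> complete \<tau> v" "\<And>u. (u, v) \<in> E \<Longrightarrow> complete \<tau> u"
    using wfE_min[of E t "{v. \<not> complete \<tau> v}"] assms by auto
  then obtain u where "(u, v) \<in> E" "\<forall>s. completion u \<le> s \<longrightarrow> s < \<tau> \<longrightarrow> sends s u \<longrightarrow>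
           sends s v \<or> (\<exists>w. w \<noteq> u \<and> (w, v) \<in> E \<and> sends s w)"
    using ex_unheard_in_neighbor by blast
  then show ?thesis using unheard_imp_crowded_now v by blast
qed

end

section \<open>The running time\<close>

text \<open>The geometric sum over the scales is dominated by its last term; 16 comes from
  \<open>10 * 2 ^ j + 6 \<le> 16 * 2 ^ j\<close>, and the added 1 makes the comparison
  strict.\<close>

definition gather_time :: "nat \<Rightarrow> nat" where
  "gather_time n = 16 * n * num_processes n * bits n * 2 ^ num_scales n + 1"

lemma sum_windows_less_gather_time:
  "(\<Sum>j<num_scales n. real n * real (window n j + window n (j + 1)) / real (2 ^ j)) < real (gather_time n)"
proof -
  let ?c = "real n * real (num_processes n) * real (bits n)"
  have "real n * real (window n j + window n (j + 1)) / real (2 ^ j) \<le> 16 * ?c * 2 ^ j" for j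
  proof -
    have "real n * real (window n j + window n (j + 1)) / real (2 ^ j) = ?c * (10 * 2 ^ j + 6)"
      by (simp add: window_def selector_length_def field_simps)
    also have "\<dots> \<le> ?c * (16 * 2 ^ j)"
      by (rule mult_left_mono) simp_all
    finally show ?thesis by simp
  qed
  then have "(\<Sum>j<num_scales n. real n * real (window n j + window n (j + 1)) / real (2 ^ j))
      \<le> (\<Sum>j<num_scales n. 16 * ?c * 2 ^ j)" by (rule sum_mono)
  also have "\<dots> = 16 * ?c * (2 ^ num_scales n - 1)"
    by (simp add: sum_distrib_left[symmetric] geometric_sum[of "2::real"])
  also have "\<dots> \<le> 16 * ?c * 2 ^ num_scales n" by (rule mult_left_mono) simp_all
  also have "\<dots> < real (gather_time n)" by (simp add: gather_time_def)
  finally show ?thesis .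
qed

lemma (in acyclic_network) complete_gather_time: "complete (gather_time n) t"
proof (rule ccontr)
  assume "\<not> complete (gather_time n) t"
  then have "\<not> complete \<tau> t" if "\<tau> < gather_time n" for \<tau>
    using complete_mono[OF _ less_imp_le[OF that]] by blast
  then have "real (gather_time n) \<le> (\<Sum>j<num_scales n. real n * real (window n j + window n (j + 1)) / real (2 ^ j))"
    by (intro crowded_times_double_counting[where c = completion and V = "\<lambda>j. window n j + window n (j + 1)"]
          incomplete_imp_crowded) auto
  with sum_windows_less_gather_time[of n] show False by simp
qed

lemma gathers_within_gather_time:
  assumes "E \<subseteq> {..<n} \<times> {..<n}" "acyclic E" "\<forall>v<n. (v, t) \<in> E\<^sup>*"
  shows "gathers_within gather n E t (gather_time n)"
proof -
  interpret acyclic_network n E by unfold_locales (use assms in auto)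
  show ?thesis
    using complete_gather_time[of t] assms(3)
    by (auto simp: gathers_within_def complete_def ancestors_def)
qed

section \<open>Asymptotic estimate\<close>

lemma bits_le_log:
  assumes "n > 0"
  shows "real (bits n) \<le> log 2 (real n) + 1"
proof -
  obtain b where b: "bits n = Suc b" using bits_pos[OF assms] by (cases "bits n") auto
  then have "\<not> n < 2 ^ b" unfolding bits_def by (intro not_less_Least) simp
  then have "real (2 ^ b) \<le> real n" by (simp only: of_nat_le_iff not_less)
  then have "log 2 (2 ^ b) \<le> log 2 (real n)" by (subst log_le_cancel_iff) (use assms in auto)
  then show ?thesis using b by simp
qed

lemma num_scales_le_bits: "num_scales n \<le> bits n"
proof -
  have "n \<le> 2 ^ bits n" using less_power_bits[of n] by simp
  also have "(2::nat) ^ bits n \<le> 4 ^ bits n" by (rule power_mono) auto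
  finally show ?thesis unfolding num_scales_def by (rule Least_le)
qed

text \<open>By minimality the preceding power of 4 is below \<open>n\<close>; take square
  roots.\<close>

lemma power_num_scales_le_sqrt:
  assumes "n > 0"
  shows "2 ^ num_scales n \<le> 2 * sqrt (real n)"
proof (cases "num_scales n")
  case 0
  have "1 \<le> sqrt (real n)" using assms by simp
  then show ?thesis unfolding 0 power_0 by linarith
next
  case (Suc j)
  then have "\<not> n \<le> 4 ^ j" unfolding num_scales_def by (intro not_less_Least) simp
  then have "real (4 ^ j) \<le> real n" by (simp only: of_nat_le_iff not_le less_imp_le)
  moreover have "(4::real) ^ j = (2 ^ j)\<^sup>2" by (simp add: power2_eq_square flip: power_mult_distrib)
  ultimately have "2 ^ j \<le> sqrt (real n)" by (intro real_le_rsqrt) simp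
  then show ?thesis using Suc by simp
qed

lemma gather_time_le:
  assumes "n \<ge> 2"
  shows "real (gather_time n) \<le> 193 * (real n powr (3 / 2) * log 2 (real n) ^ 3)"
proof -
  define l where "l = log 2 (real n)"
  have l: "l \<ge> 1" using assms by (simp add: l_def)
  have bits: "real (bits n) \<le> 2 * l" using bits_le_log[of n] l assms unfolding l_def by linarith
  have procs: "real (num_processes n) \<le> 3 * l"
    using bits_le_log[of n] num_scales_le_bits[of n] l assms
    unfolding num_processes_def l_def by linarith
  have powr: "real n powr (3 / 2) = real n * sqrt (real n)"
    using powr_add[of "real n" 1 "1 / 2"] assms by (simp add: powr_half_sqrt)
  have "real n * real (num_processes n) * real (bits n) * 2 ^ num_scales n
      \<le> real n * (3 * l) * (2 * l) * (2 * sqrt (real n))"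
    using bits procs power_num_scales_le_sqrt[of n] l assms by (intro mult_mono) auto
  then have "real (gather_time n) \<le> 192 * (real n powr (3 / 2) * l ^ 2) + 1"
    by (simp add: gather_time_def powr power2_eq_square algebra_simps)
  \<comment> \<open>Raising the exponent of \<open>l\<close> from 2 to 3 is harmless as
    \<open>l \<ge> 1\<close>, and one more copy of the main term absorbs the 1.\<close>
  also have "\<dots> \<le> 192 * (real n powr (3 / 2) * l ^ 3) + real n powr (3 / 2) * l ^ 3"
  proof (intro add_mono mult_left_mono)
    show "l ^ 2 \<le> l ^ 3" using l by (intro power_increasing) auto
    have "1 * 1 \<le> real n powr (3 / 2) * l ^ 3"
      using assms l by (intro mult_mono ge_one_powr_ge_zero one_le_power) auto
    then show "1 \<le> real n powr (3 / 2) * l ^ 3" by simp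
  qed auto
  finally show ?thesis unfolding l_def by linarith
qed

theorem theorem1:
  "\<exists>(P :: protocol) (T :: nat \<Rightarrow> nat).
     admissible_protocol P \<and>
     (\<forall>(n :: nat) (E :: (nat \<times> nat) set) (t :: nat).
        E \<subseteq> {..<n} \<times> {..<n} \<longrightarrow> acyclic E \<longrightarrow> t < n \<longrightarrow> (\<forall>v<n. (v, t) \<in> E\<^sup>*) \<longrightarrow>
        gathers_within P n E t (T n)) \<and>
     (\<lambda>n. real (T n)) \<in> O(\<lambda>n. real n powr (3 / 2) * log 2 (real n) ^ 3)"
proof (intro exI conjI allI impI)
  show "admissible_protocol gather" by (rule admissible_gather)
  show "gathers_within gather n E t (gather_time n)"
    if "E \<subseteq> {..<n} \<times> {..<n}" "acyclic E" "t < n" "\<forall>v<n. (v, t) \<in> E\<^sup>*" for n E t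
    using that by (intro gathers_within_gather_time)
  have "eventually (\<lambda>n. norm (real (gather_time n))
      \<le> 193 * norm (real n powr (3 / 2) * log 2 (real n) ^ 3)) at_top"
    using eventually_ge_at_top[of "2::nat"]
  proof eventually_elim
    case (elim n)
    have "0 \<le> log 2 (real n)" using elim by simp
    then show ?case using gather_time_le[OF elim] by (simp add: abs_mult)
  qed
  then show "(\<lambda>n. real (gather_time n)) \<in> O(\<lambda>n. real n powr (3 / 2) * log 2 (real n) ^ 3)"
    by (rule bigoI)
qed

end
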